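(* Let $k$ be an infinite field of characteristic $p>0$, let $n\ge1$, and let $R=k[[t^n,t^{n+1},\dots,t^{2n-1}]]$ be the one-dimensional local semigroup ring. Let $I$ be a tightly closed ideal of $R$. Then $*\text{-}\operatorname{core}(I)$ is also tightly closed.
   Context: $R$ is the subring of $k[[t]]$ of power series whose nonzero terms of positive degree all have degree $\ge n$. Tight closure: $x\in I^*$ iff there is $c\in R^0$ (the elements outside all minimal primes, here the nonzero elements) with $cx^q\in I^{[q]}$ for all large powers $q$ of $p$, where $I^{[q]}$ is generated by the $q$-th powers of elements of $I$. $I$ is tightly closed if $I=I^*$. A $*$-reduction of $I$ is an ideal $J$ with $J\subset I\subset J^*$; $*\text{-}\operatorname{core}(I)$ is the intersection of all $*$-reductions of $I$. *)

theory Defs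
  imports "HOL-Algebra.Algebra" "HOL-Computational_Algebra.Formal_Power_Series"
begin

definition minimal_prime :: "'r set \<Rightarrow> ('r, 'm) ring_scheme \<Rightarrow> bool" where
  "minimal_prime P R \<longleftrightarrow>
     primeideal P R \<and> (\<forall>Q. primeideal Q R \<and> Q \<subseteq> P \<longrightarrow> Q = P)"

definition outside_minimal_primes :: "('r, 'm) ring_scheme \<Rightarrow> 'r set" where
  "outside_minimal_primes R = {c \<in> carrier R. \<forall>P. minimal_prime P R \<longrightarrow> c \<notin> P}"

definition frobenius_power :: "('r, 'm) ring_scheme \<Rightarrow> nat \<Rightarrow> 'r set \<Rightarrow> 'r set" where
  "frobenius_power R q I = genideal R {x [^]\<^bsub>R\<^esub> q | x. x \<in> I}"

text \<open>In the following definitions the parameter \<open>p\<close> is the characteristic of \<open>R\<close>.\<close>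

definition tight_closure :: "('r, 'm) ring_scheme \<Rightarrow> nat \<Rightarrow> 'r set \<Rightarrow> 'r set" where
  "tight_closure R p I =
     {x \<in> carrier R. \<exists>c \<in> outside_minimal_primes R. \<exists>e0. \<forall>e\<ge>e0.
        c \<otimes>\<^bsub>R\<^esub> x [^]\<^bsub>R\<^esub> (p ^ e) \<in> frobenius_power R (p ^ e) I}"

definition tightly_closed :: "('r, 'm) ring_scheme \<Rightarrow> nat \<Rightarrow> 'r set \<Rightarrow> bool" where
  "tightly_closed R p I \<longleftrightarrow> ideal I R \<and> I = tight_closure R p I"

definition star_reduction :: "('r, 'm) ring_scheme \<Rightarrow> nat \<Rightarrow> 'r set \<Rightarrow> 'r set \<Rightarrow> bool" where
  "star_reduction R p J I \<longleftrightarrow> ideal J R \<and> J \<subseteq> I \<and> I \<subseteq> tight_closure R p J"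

definition star_core :: "('r, 'm) ring_scheme \<Rightarrow> nat \<Rightarrow> 'r set \<Rightarrow> 'r set" where
  "star_core R p I = \<Inter> {J. star_reduction R p J I}"

text \<open>
  The ring \<open>k[[t^n, t^(n+1), ..., t^(2n-1)]]\<close> for the field \<open>k = 'a\<close>: since every integer
  \<open>\<ge> n\<close> is a sum of elements of \<open>{n, ..., 2n-1}\<close>, it consists of the power series whose
  coefficients in degrees \<open>0 < i < n\<close> vanish.
\<close>

definition semigroup_ring :: "nat \<Rightarrow> ('a :: field) fps ring" where
  "semigroup_ring n =
     \<lparr>carrier = {f. \<forall>i. 0 < i \<and> i < n \<longrightarrow> fps_nth f i = 0},
      monoid.mult = (*), one = 1, ring.zero = 0, add = (+)\<rparr>"

lemma cring_semigroup_ring: "cring (semigroup_ring n :: ('a :: field) fps ring)"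
proof (rule cringI)
  let ?R = "semigroup_ring n :: 'a fps ring"
  show "abelian_group ?R"
  proof (rule abelian_groupI)
    fix x assume x: "x \<in> carrier ?R"
    show "\<exists>y\<in>carrier ?R. y \<oplus>\<^bsub>?R\<^esub> x = \<zero>\<^bsub>?R\<^esub>"
      by (rule bexI[of _ "- x"]) (use x in \<open>auto simp: semigroup_ring_def\<close>)
  qed (auto simp: semigroup_ring_def algebra_simps)
  have mult_closed: "fps_nth (x * y) i = 0"
    if x: "\<forall>i. 0 < i \<and> i < n \<longrightarrow> fps_nth x i = 0"
      and y: "\<forall>i. 0 < i \<and> i < n \<longrightarrow> fps_nth y i = 0"
      and i: "0 < i" "i < n" for x y :: "'a fps" and i
    unfolding fps_mult_nth
  proof (rule sum.neutral, rule ballI)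
    fix j assume "j \<in> {0..i}"
    then have "j < n" using i by simp
    show "fps_nth x j * fps_nth y (i - j) = 0"
      using x y i \<open>j < n\<close> by (cases "j = 0") simp_all
  qed
  show "Group.comm_monoid ?R"
    by (rule comm_monoidI) (auto simp: semigroup_ring_def algebra_simps mult_closed)
qed (auto simp: semigroup_ring_def algebra_simps)

end

theory Submission
  imports Defs
begin

text \<open>
  Extended to \<open>k[[t]]\<close>, every nonzero ideal \<open>J\<close> becomes \<open>(t^m)\<close> with \<open>m\<close> the least order occurring
  in \<open>J\<close>, and \<open>J\<^sup>*\<close> consists of all elements of \<open>R\<close> of order at least \<open>m\<close>. Hence the \<open>*\<close>-reductions of
  a tightly closed \<open>I \<noteq> 0\<close> are the ideals inside \<open>I\<close> containing an element of the least order \<open>m\<close> of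
  \<open>I\<close>. Each of them contains every series of order at least \<open>m + n\<close>, and the principal ideal generated
  by an \<open>f\<close> of order \<open>m\<close> contains no element of order strictly between \<open>m\<close> and \<open>m + n\<close>. So the core
  is the set of series of order at least \<open>m + n\<close> unless it has an element of order \<open>m\<close>, and in that
  case it is all of \<open>I\<close>.
\<close>

text \<open>The contraction of the ideal (t^m) of k[[t]] to the ring. Phrased by coefficients, so
  that the zero series needs no separate case.\<close>

definition order_ideal :: "nat \<Rightarrow> nat \<Rightarrow> 'a :: field fps set" where
  "order_ideal n m = {f \<in> carrier (semigroup_ring n). \<forall>i<m. fps_nth f i = 0}"

section \<open>Ring operations and ideals in terms of plain power series\<close>

lemma semigroup_ring_simps [simp]:
  "x \<otimes>\<^bsub>semigroup_ring n\<^esub> y = x * y"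
  "x \<oplus>\<^bsub>semigroup_ring n\<^esub> y = x + y"
  "\<one>\<^bsub>semigroup_ring n\<^esub> = 1"
  "\<zero>\<^bsub>semigroup_ring n\<^esub> = 0"
  by (simp_all add: semigroup_ring_def)

lemma carrier_semigroup_ring:
  "f \<in> carrier (semigroup_ring n) \<longleftrightarrow> (\<forall>i. 0 < i \<and> i < n \<longrightarrow> fps_nth f i = 0)"
  by (simp add: semigroup_ring_def)

lemma nat_pow_semigroup_ring [simp]:
  "x [^]\<^bsub>semigroup_ring n\<^esub> (q :: nat) = x ^ q"
  by (induction q) (simp_all add: nat_pow_def mult.commute semigroup_ring_def)

lemma ring_semigroup_ring: "ring (semigroup_ring n :: 'a :: field fps ring)"
  by (rule cring.axioms(1)[OF cring_semigroup_ring])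

lemma semigroup_ring_closed:
  fixes x y :: "'a :: field fps"
  shows "x \<in> carrier (semigroup_ring n) \<Longrightarrow> y \<in> carrier (semigroup_ring n) \<Longrightarrow>
      x * y \<in> carrier (semigroup_ring n)"
    and "x \<in> carrier (semigroup_ring n) \<Longrightarrow> x ^ q \<in> carrier (semigroup_ring n)"
  using monoid.m_closed[OF ring.is_monoid[OF ring_semigroup_ring], of x n y]
    monoid.nat_pow_closed[OF ring.is_monoid[OF ring_semigroup_ring], of x n q]
  by simp_all

lemma ideal_semigroup_ringD:
  fixes J :: "'a :: field fps set"
  assumes "ideal J (semigroup_ring n)"
  shows "J \<subseteq> carrier (semigroup_ring n)" and "0 \<in> J"
    and "a \<in> J \<Longrightarrow> b \<in> J \<Longrightarrow> a + b \<in> J"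
    and "a \<in> J \<Longrightarrow> r \<in> carrier (semigroup_ring n) \<Longrightarrow> a * r \<in> J"
proof -
  interpret ideal J "semigroup_ring n" by (rule assms)
  show "J \<subseteq> carrier (semigroup_ring n)" using a_subset .
  show "0 \<in> J" using additive_subgroup.zero_closed[OF additive_subgroup_axioms] by simp
  show "a \<in> J \<Longrightarrow> b \<in> J \<Longrightarrow> a + b \<in> J" using additive_subgroup.a_closed[OF additive_subgroup_axioms, of a b] by simp
  show "a \<in> J \<Longrightarrow> r \<in> carrier (semigroup_ring n) \<Longrightarrow> a * r \<in> J"
    using I_r_closed[of a r] by simp
qed

text \<open>Closure under negation comes for free: -1 is a constant series, hence in the ring, and
  -a = a * (-1).\<close>

lemma ideal_semigroup_ringI:
  fixes J :: "'a :: field fps set"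
  assumes "J \<subseteq> carrier (semigroup_ring n)" and "0 \<in> J"
    and add: "\<And>a b. a \<in> J \<Longrightarrow> b \<in> J \<Longrightarrow> a + b \<in> J"
    and mult: "\<And>a r. a \<in> J \<Longrightarrow> r \<in> carrier (semigroup_ring n) \<Longrightarrow> a * r \<in> J"
  shows "ideal J (semigroup_ring n)"
proof -
  let ?R = "semigroup_ring n :: 'a fps ring"
  interpret ring ?R by (rule ring_semigroup_ring)
  have neg: "\<ominus>\<^bsub>?R\<^esub> a \<in> J" if "a \<in> J" for a
  proof -
    have a: "a \<in> carrier ?R" using that assms(1) by blast
    have "a + \<ominus>\<^bsub>?R\<^esub> a = 0" using r_neg[OF a] by simp
    then have "\<ominus>\<^bsub>?R\<^esub> a = a * (-1)" by (simp add: eq_neg_iff_add_eq_0 add.commute)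
    moreover have "-1 \<in> carrier ?R" by (simp add: carrier_semigroup_ring)
    ultimately show ?thesis using mult[OF that, of "-1"] by simp
  qed
  show ?thesis
  proof (rule idealI)
    show "subgroup J (add_monoid ?R)"
      by (rule add.subgroupI) (use assms neg in \<open>auto simp flip: a_inv_def\<close>)
  qed (use mult in \<open>auto simp: mult.commute ring_semigroup_ring\<close>)
qed

text \<open>The ring is a domain, so \<open>{0}\<close> is prime; it lies in every prime and is
  therefore the only minimal one.\<close>

lemma outside_minimal_primes_semigroup_ring:
  "outside_minimal_primes (semigroup_ring n :: 'a :: field fps ring) =
     carrier (semigroup_ring n) - {0}"
proof -
  let ?R = "semigroup_ring n :: 'a fps ring"
  have zero: "primeideal {0} ?R"
  proof (rule primeidealI)
    show "ideal {0} ?R"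
      by (rule ideal_semigroup_ringI) (auto simp: carrier_semigroup_ring)
    show "carrier ?R \<noteq> {0}"
      by (metis carrier_semigroup_ring fps_one_nth less_numeral_extra(3) singletonD zero_neq_one)
  qed (auto simp: cring_semigroup_ring)
  have zero_mem: "0 \<in> P" if "primeideal P ?R" for P
    using ideal_semigroup_ringD(2)[OF primeideal.axioms(1)[OF that]] .
  have "minimal_prime P ?R \<longleftrightarrow> P = {0}" for P
    using zero zero_mem unfolding minimal_prime_def
    by (metis empty_iff insert_subset subset_singletonD empty_subsetI)
  then show ?thesis
    unfolding outside_minimal_primes_def by auto
qed

text \<open>The disjunct \<open>f = 0\<close> is there because \<open>subdegree 0\<close> is 0 by
  convention, whereas the order of the zero series should be infinite.\<close>

lemma order_ideal_iff:
  "f \<in> order_ideal n m \<longleftrightarrow> f \<in> carrier (semigroup_ring n) \<and> (f = 0 \<or> m \<le> subdegree f)"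
  unfolding order_ideal_def mem_Collect_eq
  by (metis fps_zero_nth nth_less_subdegree_zero order_less_le_trans subdegree_geI)

lemma ideal_order_ideal: "ideal (order_ideal n m) (semigroup_ring n)"
proof (rule ideal_semigroup_ringI)
  show "a * r \<in> order_ideal n m"
    if "a \<in> order_ideal n m" "r \<in> carrier (semigroup_ring n)" for a r :: "'a fps"
    using that semigroup_ring_closed(1)[of a n r]
    by (cases "a = 0"; cases "r = 0") (auto simp: order_ideal_iff)
qed (auto simp: order_ideal_def carrier_semigroup_ring)

text \<open>The conductor t^n k[[t]] lies in the ring. This is how quotients formed in k[[t]] are
  brought back into it.\<close>

lemma series_in_semigroup_ring:
  assumes "f = 0 \<or> n \<le> subdegree f"
  shows "f \<in> carrier (semigroup_ring n)"
  using assms unfolding carrier_semigroup_ring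
  by (metis fps_zero_nth nth_less_subdegree_zero order_less_le_trans)

section \<open>Tight closure described by orders\<close>

lemma subset_tight_closure:
  fixes J :: "'a :: field fps set"
  assumes J: "ideal J (semigroup_ring n)"
  shows "J \<subseteq> tight_closure (semigroup_ring n) p J"
proof
  fix x assume x: "x \<in> J"
  let ?R = "semigroup_ring n :: 'a fps ring"
  have sub: "J \<subseteq> carrier ?R" by (rule ideal_semigroup_ringD(1)[OF J])
  have "x ^ q \<in> frobenius_power ?R q J" for q
    unfolding frobenius_power_def
    by (rule subsetD[OF ring.genideal_self[OF ring_semigroup_ring]])
      (use x sub semigroup_ring_closed(2) in \<open>auto\<close>)
  then show "x \<in> tight_closure ?R p J"
    using x sub unfolding tight_closure_def outside_minimal_primes_semigroup_ring
    by (auto intro!: bexI[of _ 1] simp: carrier_semigroup_ring)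
qed

lemma order_ideal_subset_tight_closure:
  fixes J :: "'a :: field fps set"
  assumes J: "ideal J (semigroup_ring n)" and f: "f \<in> J" "f \<noteq> 0"
  shows "order_ideal n (subdegree f) \<subseteq> tight_closure (semigroup_ring n) p J"
proof
  let ?R = "semigroup_ring n :: 'a fps ring"
  have sub: "J \<subseteq> carrier ?R" by (rule ideal_semigroup_ringD(1)[OF J])
  fix x :: "'a fps" assume x: "x \<in> order_ideal n (subdegree f)"
  then have "f dvd x"
    using f by (cases "x = 0") (auto simp: order_ideal_iff fps_dvd_iff)
  then obtain s where s: "x = f * s" ..
  \<comment> \<open>The quotient \<open>s\<close> need not lie in the ring, but t^n * s^q does for
    every \<open>q\<close>. So t^n is one multiplier that serves all powers at once.\<close>
  have "fps_X ^ n * x ^ q \<in> frobenius_power ?R q J" for q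
  proof -
    have gen: "{x [^]\<^bsub>?R\<^esub> q | x. x \<in> J} \<subseteq> carrier ?R"
      using sub semigroup_ring_closed(2) by auto
    have "f ^ q \<in> frobenius_power ?R q J"
      unfolding frobenius_power_def
      by (rule subsetD[OF ring.genideal_self[OF ring_semigroup_ring gen]]) (use f in auto)
    moreover have "fps_X ^ n * s ^ q \<in> carrier ?R"
    proof (rule series_in_semigroup_ring)
      show "fps_X ^ n * s ^ q = 0 \<or> n \<le> subdegree (fps_X ^ n * s ^ q)"
        by (cases "s ^ q = 0") (simp_all add: subdegree_mult)
    qed
    moreover have "ideal (frobenius_power ?R q J) ?R"
      unfolding frobenius_power_def
      by (rule ring.genideal_ideal[OF ring_semigroup_ring gen])
    ultimately have "f ^ q * (fps_X ^ n * s ^ q) \<in> frobenius_power ?R q J"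
      by (metis ideal_semigroup_ringD(4))
    then show ?thesis by (simp add: s power_mult_distrib ac_simps)
  qed
  moreover have "fps_X ^ n \<in> carrier ?R - {0}"
    by (auto intro: series_in_semigroup_ring)
  ultimately have "\<exists>c \<in> carrier ?R - {0}. \<exists>e0. \<forall>e\<ge>e0.
      c * x ^ (p ^ e) \<in> frobenius_power ?R (p ^ e) J"
    by blast
  then show "x \<in> tight_closure ?R p J"
    using x unfolding tight_closure_def outside_minimal_primes_semigroup_ring
    by (simp add: order_ideal_def)
qed

text \<open>Orders are compared: c * x^q in the Frobenius power forces m * q \<le> ord c + q * ord
  x. If ord x < m, this gives q \<le> ord c, which fails for large \<open>q\<close>.\<close>

lemma tight_closure_subset_order_ideal:
  fixes J :: "'a :: field fps set"
  assumes p: "p > 1" and J: "J \<subseteq> order_ideal n m"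
  shows "tight_closure (semigroup_ring n) p J \<subseteq> order_ideal n m"
proof
  let ?R = "semigroup_ring n :: 'a fps ring"
  fix x assume "x \<in> tight_closure ?R p J"
  then obtain c e0 where x: "x \<in> carrier ?R" and c: "c \<noteq> 0"
    and e0: "\<And>e. e \<ge> e0 \<Longrightarrow> c * x ^ (p ^ e) \<in> frobenius_power ?R (p ^ e) J"
    unfolding tight_closure_def outside_minimal_primes_semigroup_ring by auto
  have frob: "frobenius_power ?R q J \<subseteq> order_ideal n (m * q)" if "q > 0" for q
    unfolding frobenius_power_def
  proof (rule ring.genideal_minimal[OF ring_semigroup_ring ideal_order_ideal], rule subsetI)
    fix y assume "y \<in> {x [^]\<^bsub>?R\<^esub> q | x. x \<in> J}"
    then obtain z where "z \<in> order_ideal n m" "y = z ^ q" using J by auto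
    then show "y \<in> order_ideal n (m * q)"
      using semigroup_ring_closed(2)[of z n q] that
      by (auto simp: order_ideal_iff mult.commute)
  qed
  show "x \<in> order_ideal n m"
  proof (rule ccontr)
    assume "x \<notin> order_ideal n m"
    then have x0: "x \<noteq> 0" and less: "subdegree x + 1 \<le> m"
      using x by (auto simp: order_ideal_iff)
    \<comment> \<open>The exponent is at least \<open>e0\<close>, so the hypothesis applies, and at
      least ord c, so that p^e > e makes \<open>q\<close> exceed ord c.\<close>
    define q where "q = p ^ (e0 + subdegree c)"
    have "e0 + subdegree c < q" unfolding q_def by (rule power_gt_expt) (use p in simp)
    then have q: "subdegree c < q" by simp
    have "c * x ^ q \<in> order_ideal n (m * q)"
      using e0[of "e0 + subdegree c", folded q_def] frob[of q] q by auto
    then have "m * q \<le> subdegree c + q * subdegree x"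
      using c x0 by (simp add: order_ideal_iff)
    moreover have "(subdegree x + 1) * q \<le> m * q" using less by (rule mult_le_mono1)
    ultimately show False using q by (simp add: algebra_simps)
  qed
qed

lemma tightly_closed_order_ideal:
  assumes "p > 1"
  shows "tightly_closed (semigroup_ring n) p (order_ideal n m)"
  unfolding tightly_closed_def
  using ideal_order_ideal subset_tight_closure[OF ideal_order_ideal]
    tight_closure_subset_order_ideal[OF assms subset_refl] by blast

text \<open>Take \<open>f\<close> of least order in \<open>I\<close>. Minimality bounds
  \<open>I\<close> from above; from below, every ring element of at least that order lies in the
  tight closure of \<open>I\<close>, which is \<open>I\<close>.\<close>

lemma nonzero_tightly_closed_is_order_ideal:
  fixes I :: "'a :: field fps set"
  assumes p: "p > 1" and I: "tightly_closed (semigroup_ring n) p I" and "I \<noteq> {0}"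
  obtains f where "f \<noteq> 0" "I = order_ideal n (subdegree f)" "f \<in> I"
proof -
  have ideal: "ideal I (semigroup_ring n)" using I by (simp add: tightly_closed_def)
  have "\<exists>f. f \<in> I \<and> f \<noteq> 0" using ideal_semigroup_ringD(2)[OF ideal] \<open>I \<noteq> {0}\<close> by auto
  then obtain f where f: "f \<in> I \<and> f \<noteq> 0"
    and least: "\<And>g. g \<in> I \<and> g \<noteq> 0 \<Longrightarrow> subdegree f \<le> subdegree g"
    using ex_has_least_nat[of "\<lambda>f. f \<in> I \<and> f \<noteq> 0" _ subdegree] by blast
  have "I \<subseteq> order_ideal n (subdegree f)"
    unfolding order_ideal_iff subset_iff
    using least ideal_semigroup_ringD(1)[OF ideal] by blast
  moreover have "order_ideal n (subdegree f) \<subseteq> I"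
    using order_ideal_subset_tight_closure[OF ideal, of f p] f I
    by (auto simp: tightly_closed_def)
  ultimately show ?thesis using f that by blast
qed

section \<open>Star reductions and the star core\<close>

lemma star_core_zero:
  "star_core (semigroup_ring n) p {0 :: 'a :: field fps} = {0}"
proof -
  let ?R = "semigroup_ring n :: 'a fps ring"
  have ideal: "ideal {0} ?R"
    by (rule ideal_semigroup_ringI) (auto simp: carrier_semigroup_ring)
  have "star_reduction ?R p {0} {0}"
    unfolding star_reduction_def using ideal subset_tight_closure[OF ideal] by blast
  moreover have "0 \<in> J" if "star_reduction ?R p J {0}" for J
    using that ideal_semigroup_ringD(2) unfolding star_reduction_def by blast
  ultimately show ?thesis unfolding star_core_def by blast
qed

lemma tightly_closed_zero:
  assumes "p > 1"
  shows "tightly_closed (semigroup_ring n) p {0 :: 'a :: field fps}"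
proof -
  let ?R = "semigroup_ring n :: 'a fps ring"
  have ideal: "ideal {0} ?R"
    by (rule ideal_semigroup_ringI) (auto simp: carrier_semigroup_ring)
  \<comment> \<open>The zero ideal lies in all order ideals, and their intersection over all
    \<open>m\<close> is zero.\<close>
  have "tight_closure ?R p {0} \<subseteq> order_ideal n m" for m
    by (rule tight_closure_subset_order_ideal[OF assms])
      (auto simp: order_ideal_def carrier_semigroup_ring)
  then have "x = 0" if "x \<in> tight_closure ?R p {0}" for x
    using that by (force simp: order_ideal_def fps_eq_iff)
  then show ?thesis
    using ideal subset_tight_closure[OF ideal, of p] by (auto simp: tightly_closed_def)
qed

text \<open>Dividing by \<open>f\<close> in k[[t]] leaves a quotient that is zero or of order at
  least \<open>n\<close>, hence in the ring.\<close>

lemma order_ideal_subset_ideal: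
  fixes J :: "'a :: field fps set"
  assumes J: "ideal J (semigroup_ring n)" and f: "f \<in> J" "f \<noteq> 0"
  shows "order_ideal n (subdegree f + n) \<subseteq> J"
proof
  fix g :: "'a fps" assume g: "g \<in> order_ideal n (subdegree f + n)"
  then have "f dvd g"
    using f by (cases "g = 0") (auto simp: order_ideal_iff fps_dvd_iff)
  then obtain s where s: "g = f * s" ..
  have "s \<in> carrier (semigroup_ring n)"
    by (rule series_in_semigroup_ring, cases "s = 0")
      (use g f s in \<open>auto simp: order_ideal_iff\<close>)
  then show "g \<in> J" using ideal_semigroup_ringD(4)[OF J f(1)] s by simp
qed

text \<open>A \<open>J\<close> without elements of the least order sits in the next order ideal,
  which then also contains the tight closure of \<open>J\<close> and so excludes
  \<open>f\<close>.\<close>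

lemma star_reduction_order_ideal_iff:
  fixes f :: "'a :: field fps" and J :: "'a fps set"
  assumes p: "p > 1" and f: "f \<in> carrier (semigroup_ring n)" "f \<noteq> 0"
  shows "star_reduction (semigroup_ring n) p J (order_ideal n (subdegree f)) \<longleftrightarrow>
    ideal J (semigroup_ring n) \<and> J \<subseteq> order_ideal n (subdegree f) \<and>
    (\<exists>g\<in>J. g \<noteq> 0 \<and> subdegree g = subdegree f)"
proof -
  let ?R = "semigroup_ring n :: 'a fps ring" and ?m = "subdegree f"
  have "\<exists>g\<in>J. g \<noteq> 0 \<and> subdegree g = ?m"
    if "J \<subseteq> order_ideal n ?m" "order_ideal n ?m \<subseteq> tight_closure ?R p J"
  proof (rule ccontr)
    assume "\<not> ?thesis"
    then have "J \<subseteq> order_ideal n (Suc ?m)"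
      using that(1) unfolding subset_iff order_ideal_iff by (metis Suc_leI order_le_less)
    then have "order_ideal n ?m \<subseteq> (order_ideal n (Suc ?m) :: 'a fps set)"
      using that(2) tight_closure_subset_order_ideal[OF p] by blast
    then show False using f by (auto simp: order_ideal_iff)
  qed
  then show ?thesis
    unfolding star_reduction_def
    by (metis order_ideal_subset_tight_closure)
qed

lemma tightly_closed_star_core_order_ideal:
  fixes f :: "'a :: field fps"
  assumes p: "p > 1" and f: "f \<in> carrier (semigroup_ring n)" "f \<noteq> 0"
  shows "tightly_closed (semigroup_ring n) p
    (star_core (semigroup_ring n) p (order_ideal n (subdegree f) :: 'a fps set))"
proof -
  let ?R = "semigroup_ring n :: 'a fps ring"
  define m where "m = subdegree f"
  define C where "C = star_core ?R p (order_ideal n m)"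
  note red_iff = star_reduction_order_ideal_iff[OF p f, folded m_def]
  \<comment> \<open>This makes the family intersected in \<open>C\<close> nonempty, which both the
    upper bound and the ideal property of \<open>C\<close> require.\<close>
  have "star_reduction ?R p (order_ideal n m) (order_ideal n m)"
    unfolding star_reduction_def
    using ideal_order_ideal subset_tight_closure[OF ideal_order_ideal] by blast
  then have C_sub: "C \<subseteq> order_ideal n m" and C_ideal: "ideal C ?R"
    unfolding C_def star_core_def
    by (blast, intro ring.i_Intersect[OF ring_semigroup_ring])
      (auto simp: star_reduction_def)
  have lower: "order_ideal n (m + n) \<subseteq> C"
    unfolding C_def star_core_def red_iff
    using order_ideal_subset_ideal by blast
  \<comment> \<open>The principal ideal of any \<open>h\<close> of order \<open>m\<close> is itself
    a star reduction, so the core lies in each of these ideals.\<close>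
  have principal: "\<exists>r\<in>carrier ?R. g = h * r"
    if g: "g \<in> C" and h: "h \<in> carrier ?R" "h \<noteq> 0" "subdegree h = m" for g h :: "'a fps"
  proof -
    let ?J = "(\<lambda>r. h * r) ` carrier ?R"
    have "ideal ?J ?R"
    proof (rule ideal_semigroup_ringI)
      show "a + b \<in> ?J" if "a \<in> ?J" "b \<in> ?J" for a b
      proof -
        from that obtain r s where "a = h * r" "b = h * s" "r \<in> carrier ?R" "s \<in> carrier ?R"
          by auto
        then show ?thesis
          by (intro image_eqI[of _ _ "r + s"]) (auto simp: carrier_semigroup_ring algebra_simps)
      qed
      show "a * r \<in> ?J" if "a \<in> ?J" "r \<in> carrier ?R" for a r
        using that semigroup_ring_closed(1) by (auto simp: mult.assoc intro!: imageI)
      show "0 \<in> ?J" by (rule image_eqI[of _ _ 0]) (auto simp: carrier_semigroup_ring)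
    qed (use h semigroup_ring_closed(1) in auto)
    moreover have "h \<in> ?J" by (rule image_eqI[of _ _ 1]) (auto simp: carrier_semigroup_ring)
    moreover have "?J \<subseteq> order_ideal n m"
      using h ideal_semigroup_ringD(4)[OF ideal_order_ideal, of h n m]
      by (auto simp: order_ideal_iff[of h])
    ultimately have "star_reduction ?R p ?J (order_ideal n m)"
      unfolding red_iff using h by blast
    then show ?thesis using g unfolding C_def star_core_def by blast
  qed
  show ?thesis
  proof (cases "C \<subseteq> order_ideal n (m + n)")
    case True
    then show ?thesis
      using lower tightly_closed_order_ideal[OF p] unfolding C_def m_def by (metis subset_antisym)
  next
    case False
    then obtain g where g: "g \<in> C" "g \<notin> order_ideal n (m + n)" by blast
    \<comment> \<open>Write g = h * r. As \<open>g\<close> has order below m + n, \<open>r\<close>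
      has order below \<open>n\<close>; the ring has no orders strictly between 0 and
      \<open>n\<close>, so \<open>r\<close> has a nonzero constant term. Thus \<open>h\<close> is a
      multiple of \<open>g\<close> up to an error in \<open>order_ideal n (m + n)\<close>.\<close>
    have order_m: "h \<in> C" if h: "h \<in> carrier ?R" "h \<noteq> 0" "subdegree h = m" for h
    proof -
      obtain r where r: "r \<in> carrier ?R" "g = h * r" using principal[OF g(1) h] by blast
      have "g \<in> carrier ?R" using r h semigroup_ring_closed(1) by blast
      then have "r \<noteq> 0" "subdegree r < n"
        using g(2) r h by (auto simp: order_ideal_iff)
      then have r0: "fps_nth r 0 \<noteq> 0"
        using r(1) by (metis carrier_semigroup_ring gr0I nth_subdegree_nonzero)
      \<comment> \<open>Scaling makes the constant term of a * r equal to 1, so 1 - a * r has no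
        terms below degree \<open>n\<close>.\<close>
      define a where "a = fps_const (inverse (fps_nth r 0))"
      have a: "a \<in> carrier ?R" by (simp add: a_def carrier_semigroup_ring)
      define s where "s = 1 - a * r"
      have s: "s = 0 \<or> n \<le> subdegree s"
      proof (cases "s = 0")
        case False
        have "fps_nth s i = 0" if "i < n" for i
          using that r0 r(1) by (cases "i = 0") (auto simp: s_def a_def carrier_semigroup_ring)
        then show ?thesis using False by (auto intro: subdegree_geI)
      qed simp
      have "h * s \<in> order_ideal n (m + n)"
        using s h semigroup_ring_closed(1)[OF h(1) series_in_semigroup_ring[OF s]]
        by (cases "s = 0") (auto simp: order_ideal_iff)
      then have "h * s \<in> C" using lower by blast
      moreover have "g * a \<in> C" using ideal_semigroup_ringD(4)[OF C_ideal g(1) a] .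
      moreover have "h = g * a + h * s" by (simp add: s_def r(2) algebra_simps)
      ultimately show ?thesis using ideal_semigroup_ringD(3)[OF C_ideal] by metis
    qed
    have "h \<in> C" if h: "h \<in> order_ideal n m" for h
    proof (cases "fps_nth h m = 0")
      case False
      then have "h \<noteq> 0" by (metis fps_zero_nth)
      moreover have "subdegree h = m"
        using False h by (intro subdegreeI) (auto simp: order_ideal_def)
      ultimately show ?thesis using h order_m unfolding order_ideal_def by blast
    next
      case True
      \<comment> \<open>An \<open>h\<close> of order above \<open>m\<close> is the sum of h + f and
        -f, both of order exactly \<open>m\<close>.\<close>
      have fm: "fps_nth f m \<noteq> 0" using f by (simp add: m_def)
      have low: "fps_nth f i = 0" if "i < m" for i
        using that unfolding m_def by (rule nth_less_subdegree_zero)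
      have fc: "- f \<in> C" by (rule order_m) (use f in \<open>auto simp: carrier_semigroup_ring m_def\<close>)
      have "subdegree (h + f) = m"
        by (rule subdegreeI)
          (use h True fm low in \<open>simp_all add: order_ideal_def\<close>)
      moreover have "h + f \<noteq> 0" using True fm by (metis fps_add_nth add_0 fps_zero_nth)
      moreover have "h + f \<in> carrier ?R"
        using h f by (auto simp: order_ideal_def carrier_semigroup_ring)
      ultimately have "h + f \<in> C" by (intro order_m)
      then have "h + f + (- f) \<in> C" using fc by (rule ideal_semigroup_ringD(3)[OF C_ideal])
      then show ?thesis by simp
    qed
    then have "C = order_ideal n m" using C_sub by blast
    then show ?thesis using tightly_closed_order_ideal[OF p] unfolding C_def m_def by metis
  qed
qed

theorem proposition5p4:
  fixes I :: "('a :: field) fps set" and n p :: nat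
  assumes "infinite (UNIV :: 'a set)"
    and "p = CHAR('a)" and "p > 0"
    and "n \<ge> 1"
    and "tightly_closed (semigroup_ring n) p I"
  shows "tightly_closed (semigroup_ring n) p (star_core (semigroup_ring n) p I)"
proof -
  \<comment> \<open>The positive characteristic of a field is prime; p > 1 is what makes the powers
    p^e unbounded.\<close>
  have p: "p > 1"
    using prime_CHAR_semidom[where 'a = 'a] assms(2,3) prime_gt_1_nat by auto
  show ?thesis
  \<comment> \<open>The zero ideal has no element of least order and is treated apart.\<close>
  proof (cases "I = {0}")
    case True
    then show ?thesis using tightly_closed_zero[OF p] by (simp add: star_core_zero)
  next
    case False
    obtain f where f: "f \<noteq> 0" "I = order_ideal n (subdegree f)" "f \<in> I"
      using nonzero_tightly_closed_is_order_ideal[OF p assms(5) False] .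
    have "f \<in> carrier (semigroup_ring n)"
      using ideal_semigroup_ringD(1) assms(5) f(3) unfolding tightly_closed_def by blast
    from tightly_closed_star_core_order_ideal[OF p this f(1)] show ?thesis
      by (simp only: f(2)[symmetric])
  qed
qed

end
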